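(* Let $P:\mathbb C^{\mathrm{op}}\to\mathbf{Pos}$ be a primary doctrine, $X$ an object of $\mathbb C$ and $\varphi\in P(X)$, and let $P_{(X,\varphi)}$ be the associated Kleisli doctrine with canonical 1-arrow $(F_X,\mathfrak f):P\to P_{(X,\varphi)}$. If $P$ has binary joins, then $P_{(X,\varphi)}$ has binary joins. If (moreover) each fiber of $P$ is a distributive lattice, then $(F_X,\mathfrak f)$ preserves binary joins.
   Context: A doctrine is a functor $P:\mathbb C^{\mathrm{op}}\to\mathbf{Pos}$ with $\mathbb C$ a category with finite products and $\mathbf{Pos}$ the category of posets and monotone maps; the posets $P(A)$ are called fibers and the maps $P(f)$ reindexings. It is primary if every $P(A)$ has finite meets ($\wedge$, $\top$) and all reindexings preserve them. It has binary joins if every $P(A)$ has binary joins and all reindexings preserve them. A 1-arrow (doctrine homomorphism) from $P:\mathbb C^{\mathrm{op}}\to\mathbf{Pos}$ to $R:\mathbb D^{\mathrm{op}}\to\mathbf{Pos}$ is a pair $(F,\mathfrak f)$ with $F:\mathbb C\to\mathbb D$ a finite-product-preserving functor and $\mathfrak f:P\to R\circ F^{\mathrm{op}}$ natural; it preserves binary joins if each $\mathfrak f_A$ does. Kleisli doctrine (the Kleisli object of the comonad on $P$ given by $X\times-$ and $\alpha\mapsto P(\mathrm{pr}_1)(\varphi)\wedge P(\mathrm{pr}_2)(\alpha)$). The category $\mathbb C_X$ has the same objects as $\mathbb C$; an arrow $g:A\rightsquigarrow B$ in $\mathbb C_X$ is a $\mathbb C$-arrow $g:X\times A\to B$; the identity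 of $A$ is $\mathrm{pr}_2:X\times A\to A$; the composite of $g:A\rightsquigarrow B$ and $h:B\rightsquigarrow C$ is $h\langle\mathrm{pr}_1,g\rangle$. It has finite products, given on objects by those of $\mathbb C$. The doctrine $P_{(X,\varphi)}:\mathbb C_X^{\mathrm{op}}\to\mathbf{Pos}$ has $P_{(X,\varphi)}(A)=\{\alpha\in P(X\times A)\mid\alpha\le P(\mathrm{pr}_1)(\varphi)\}$ with the order of $P(X\times A)$, and reindexing along $g:A\rightsquigarrow B$ is the restriction of $P(\langle\mathrm{pr}_1,g\rangle)$. The 1-arrow $(F_X,\mathfrak f):P\to P_{(X,\varphi)}$: $F_X:\mathbb C\to\mathbb C_X$ is the identity on objects and sends $f:A\to B$ to $f\,\mathrm{pr}_2:A\rightsquigarrow B$; $\mathfrak f_A(\alpha)=P(\mathrm{pr}_1)(\varphi)\wedge P(\mathrm{pr}_2)(\alpha)$, for $\mathrm{pr}_1,\mathrm{pr}_2$ the projections from $X\times A$. *)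

theory Defs
  imports "HOL-Algebra.Lattice"
begin

section \<open>Categories with finite products\<close>

text \<open>
  Hom-sets are indexed by their end points and are \<^emph>\<open>not\<close> assumed to be pairwise disjoint, so
  an arrow does not determine its domain and codomain. Every operation that depends on them (composition,
  reindexing, the arrow part of a functor) therefore takes the objects as arguments. With this
  convention the hom-set \<open>X \<times> A \<rightarrow> B\<close> can be used literally as the hom-set
  \<open>A \<leadsto> B\<close> of the Kleisli category, although \<open>A\<close> cannot in general be recovered from
  \<open>X \<times> A\<close>. \<open>Comp C A B D g f\<close> is the composite of \<open>f : A \<rightarrow> B\<close> and \<open>g : B \<rightarrow> D\<close>.
\<close>

record ('o, 'm) category =
  Ob :: "'o set"
  Hom :: "'o \<Rightarrow> 'o \<Rightarrow> 'm set"
  Id :: "'o \<Rightarrow> 'm"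
  Comp :: "'o \<Rightarrow> 'o \<Rightarrow> 'o \<Rightarrow> 'm \<Rightarrow> 'm \<Rightarrow> 'm"

locale category =
  fixes C :: "('o, 'm, 'z) category_scheme"
  assumes Id_closed: "A \<in> Ob C \<Longrightarrow> Id C A \<in> Hom C A A"
    and Comp_closed:
      "\<lbrakk>A \<in> Ob C; B \<in> Ob C; D \<in> Ob C; f \<in> Hom C A B; g \<in> Hom C B D\<rbrakk>
        \<Longrightarrow> Comp C A B D g f \<in> Hom C A D"
    and Comp_Id_right:
      "\<lbrakk>A \<in> Ob C; B \<in> Ob C; f \<in> Hom C A B\<rbrakk> \<Longrightarrow> Comp C A A B f (Id C A) = f"
    and Comp_Id_left:
      "\<lbrakk>A \<in> Ob C; B \<in> Ob C; f \<in> Hom C A B\<rbrakk> \<Longrightarrow> Comp C A B B (Id C B) f = f"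
    and Comp_assoc:
      "\<lbrakk>A \<in> Ob C; B \<in> Ob C; D \<in> Ob C; E \<in> Ob C;
        f \<in> Hom C A B; g \<in> Hom C B D; h \<in> Hom C D E\<rbrakk>
        \<Longrightarrow> Comp C A D E h (Comp C A B D g f) = Comp C A B E (Comp C B D E h g) f"

definition is_terminal :: "('o, 'm, 'z) category_scheme \<Rightarrow> 'o \<Rightarrow> bool" where
  "is_terminal C T \<longleftrightarrow> T \<in> Ob C \<and> (\<forall>Z\<in>Ob C. \<exists>!h. h \<in> Hom C Z T)"

definition is_product ::
    "('o, 'm, 'z) category_scheme \<Rightarrow> 'o \<Rightarrow> 'o \<Rightarrow> 'o \<Rightarrow> 'm \<Rightarrow> 'm \<Rightarrow> bool" where
  "is_product C A B Q p q \<longleftrightarrow>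
     Q \<in> Ob C \<and> p \<in> Hom C Q A \<and> q \<in> Hom C Q B \<and>
     (\<forall>Z\<in>Ob C. \<forall>f\<in>Hom C Z A. \<forall>g\<in>Hom C Z B.
        \<exists>!h. h \<in> Hom C Z Q \<and> Comp C Z Q A p h = f \<and> Comp C Z Q B q h = g)"

text \<open>
  Finite products are given by a choice of a terminal object and of binary products. The choice is
  arbitrary, and functors are only required to preserve products up to isomorphism.
\<close>

record ('o, 'm) fp_category = "('o, 'm) category" +
  One :: "'o"
  Prod :: "'o \<Rightarrow> 'o \<Rightarrow> 'o"
  Pr1 :: "'o \<Rightarrow> 'o \<Rightarrow> 'm"
  Pr2 :: "'o \<Rightarrow> 'o \<Rightarrow> 'm"

locale fp_category = category C for C :: "('o, 'm, 'z) fp_category_scheme" +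
  assumes One_terminal: "is_terminal C (One C)"
    and Prod_product:
      "\<lbrakk>A \<in> Ob C; B \<in> Ob C\<rbrakk> \<Longrightarrow> is_product C A B (Prod C A B) (Pr1 C A B) (Pr2 C A B)"

text \<open>\<open>pairing C Z A B f g\<close> is \<open>\<langle>f, g\<rangle> : Z \<rightarrow> A \<times> B\<close>.\<close>

definition pairing :: "('o, 'm, 'z) fp_category_scheme \<Rightarrow> 'o \<Rightarrow> 'o \<Rightarrow> 'o \<Rightarrow> 'm \<Rightarrow> 'm \<Rightarrow> 'm" where
  "pairing C Z A B f g =
     (THE h. h \<in> Hom C Z (Prod C A B) \<and>
        Comp C Z (Prod C A B) A (Pr1 C A B) h = f \<and>
        Comp C Z (Prod C A B) B (Pr2 C A B) h = g)"

locale fp_functor = src: fp_category C + tgt: fp_category D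
  for C :: "('o, 'm, 'z) fp_category_scheme" and D :: "('p, 'n, 'y) fp_category_scheme" +
  fixes F\<^sub>o :: "'o \<Rightarrow> 'p" and F\<^sub>a :: "'o \<Rightarrow> 'o \<Rightarrow> 'm \<Rightarrow> 'n"
  assumes obj_closed: "A \<in> Ob C \<Longrightarrow> F\<^sub>o A \<in> Ob D"
    and arr_closed:
      "\<lbrakk>A \<in> Ob C; B \<in> Ob C; f \<in> Hom C A B\<rbrakk> \<Longrightarrow> F\<^sub>a A B f \<in> Hom D (F\<^sub>o A) (F\<^sub>o B)"
    and arr_Id: "A \<in> Ob C \<Longrightarrow> F\<^sub>a A A (Id C A) = Id D (F\<^sub>o A)"
    and arr_Comp:
      "\<lbrakk>A \<in> Ob C; B \<in> Ob C; E \<in> Ob C; f \<in> Hom C A B; g \<in> Hom C B E\<rbrakk>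
        \<Longrightarrow> F\<^sub>a A E (Comp C A B E g f) = Comp D (F\<^sub>o A) (F\<^sub>o B) (F\<^sub>o E) (F\<^sub>a B E g) (F\<^sub>a A B f)"
    and preserves_One: "is_terminal D (F\<^sub>o (One C))"
    and preserves_Prod:
      "\<lbrakk>A \<in> Ob C; B \<in> Ob C\<rbrakk> \<Longrightarrow>
        is_product D (F\<^sub>o A) (F\<^sub>o B) (F\<^sub>o (Prod C A B))
          (F\<^sub>a (Prod C A B) A (Pr1 C A B)) (F\<^sub>a (Prod C A B) B (Pr2 C A B))"


section \<open>Doctrines\<close>

text \<open>\<open>reidx P A B f : P(B) \<rightarrow> P(A)\<close> is the reindexing along \<open>f : A \<rightarrow> B\<close>.\<close>

record ('o, 'm, 'a) doctrine =
  base :: "('o, 'm) fp_category"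
  fib :: "'o \<Rightarrow> 'a gorder"
  reidx :: "'o \<Rightarrow> 'o \<Rightarrow> 'm \<Rightarrow> 'a \<Rightarrow> 'a"

locale doctrine = fp_category "base P" for P :: "('o, 'm, 'a) doctrine" +
  assumes fib_order: "A \<in> Ob (base P) \<Longrightarrow> partial_order (fib P A)"
    and reidx_closed:
      "\<lbrakk>A \<in> Ob (base P); B \<in> Ob (base P); f \<in> Hom (base P) A B\<rbrakk>
        \<Longrightarrow> reidx P A B f \<in> carrier (fib P B) \<rightarrow> carrier (fib P A)"
    and reidx_mono:
      "\<lbrakk>A \<in> Ob (base P); B \<in> Ob (base P); f \<in> Hom (base P) A B\<rbrakk>
        \<Longrightarrow> isotone (fib P B) (fib P A) (reidx P A B f)"
    and reidx_Id:
      "\<lbrakk>A \<in> Ob (base P); \<alpha> \<in> carrier (fib P A)\<rbrakk> \<Longrightarrow> reidx P A A (Id (base P) A) \<alpha> = \<alpha>"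
    and reidx_Comp:
      "\<lbrakk>A \<in> Ob (base P); B \<in> Ob (base P); D \<in> Ob (base P);
        f \<in> Hom (base P) A B; g \<in> Hom (base P) B D; \<alpha> \<in> carrier (fib P D)\<rbrakk>
        \<Longrightarrow> reidx P A D (Comp (base P) A B D g f) \<alpha> = reidx P A B f (reidx P B D g \<alpha>)"

locale primary_doctrine = doctrine +
  assumes fib_meets: "A \<in> Ob (base P) \<Longrightarrow> lower_semilattice (fib P A)"
    and fib_top: "A \<in> Ob (base P) \<Longrightarrow> weak_partial_order_top (fib P A)"
    and reidx_meet:
      "\<lbrakk>A \<in> Ob (base P); B \<in> Ob (base P); f \<in> Hom (base P) A B;
        \<alpha> \<in> carrier (fib P B); \<beta> \<in> carrier (fib P B)\<rbrakk>
        \<Longrightarrow> reidx P A B f (\<alpha> \<sqinter>\<^bsub>fib P B\<^esub> \<beta>) = reidx P A B f \<alpha> \<sqinter>\<^bsub>fib P A\<^esub> reidx P A B f \<beta>"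
    and reidx_top:
      "\<lbrakk>A \<in> Ob (base P); B \<in> Ob (base P); f \<in> Hom (base P) A B\<rbrakk>
        \<Longrightarrow> reidx P A B f \<top>\<^bsub>fib P B\<^esub> = \<top>\<^bsub>fib P A\<^esub>"

locale binary_join_doctrine = doctrine +
  assumes fib_joins: "A \<in> Ob (base P) \<Longrightarrow> upper_semilattice (fib P A)"
    and reidx_join:
      "\<lbrakk>A \<in> Ob (base P); B \<in> Ob (base P); f \<in> Hom (base P) A B;
        \<alpha> \<in> carrier (fib P B); \<beta> \<in> carrier (fib P B)\<rbrakk>
        \<Longrightarrow> reidx P A B f (\<alpha> \<squnion>\<^bsub>fib P B\<^esub> \<beta>) = reidx P A B f \<alpha> \<squnion>\<^bsub>fib P A\<^esub> reidx P A B f \<beta>"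

locale distributive_lattice = lattice +
  assumes meet_join_distrib:
    "\<lbrakk>x \<in> carrier L; y \<in> carrier L; z \<in> carrier L\<rbrakk> \<Longrightarrow> x \<sqinter> (y \<squnion> z) = (x \<sqinter> y) \<squnion> (x \<sqinter> z)"

record ('o, 'm, 'a, 'p, 'n, 'b) one_arrow =
  obj_map :: "'o \<Rightarrow> 'p"
  arr_map :: "'o \<Rightarrow> 'o \<Rightarrow> 'm \<Rightarrow> 'n"
  fib_map :: "'o \<Rightarrow> 'a \<Rightarrow> 'b"

locale one_arrow =
  src: doctrine P + tgt: doctrine R + fp_functor "base P" "base R" "obj_map H" "arr_map H"
  for P :: "('o, 'm, 'a) doctrine" and R :: "('p, 'n, 'b) doctrine"
    and H :: "('o, 'm, 'a, 'p, 'n, 'b) one_arrow" +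
  assumes fib_map_closed:
      "A \<in> Ob (base P) \<Longrightarrow> fib_map H A \<in> carrier (fib P A) \<rightarrow> carrier (fib R (obj_map H A))"
    and fib_map_mono:
      "A \<in> Ob (base P) \<Longrightarrow> isotone (fib P A) (fib R (obj_map H A)) (fib_map H A)"
    and fib_map_natural:
      "\<lbrakk>A \<in> Ob (base P); B \<in> Ob (base P); f \<in> Hom (base P) A B; \<alpha> \<in> carrier (fib P B)\<rbrakk>
        \<Longrightarrow> fib_map H A (reidx P A B f \<alpha>) =
            reidx R (obj_map H A) (obj_map H B) (arr_map H A B f) (fib_map H B \<alpha>)"

locale binary_join_preserving_one_arrow =
  one_arrow P R H + src: binary_join_doctrine P + tgt: binary_join_doctrine R
  for P :: "('o, 'm, 'a) doctrine" and R :: "('p, 'n, 'b) doctrine"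
    and H :: "('o, 'm, 'a, 'p, 'n, 'b) one_arrow" +
  assumes fib_map_join:
    "\<lbrakk>A \<in> Ob (base P); \<alpha> \<in> carrier (fib P A); \<beta> \<in> carrier (fib P A)\<rbrakk>
      \<Longrightarrow> fib_map H A (\<alpha> \<squnion>\<^bsub>fib P A\<^esub> \<beta>) = fib_map H A \<alpha> \<squnion>\<^bsub>fib R (obj_map H A)\<^esub> fib_map H A \<beta>"


section \<open>The Kleisli doctrine\<close>

text \<open>
  The projections of the Kleisli category are the images of those of \<open>C\<close> under
  \<open>f \<mapsto> f pr\<^sub>2\<close>.
\<close>

definition kleisli_category :: "('o, 'm) fp_category \<Rightarrow> 'o \<Rightarrow> ('o, 'm) fp_category" where
  "kleisli_category C X =
     \<lparr>Ob = Ob C,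
      Hom = (\<lambda>A B. Hom C (Prod C X A) B),
      Id = (\<lambda>A. Pr2 C X A),
      Comp = (\<lambda>A B D h g.
        Comp C (Prod C X A) (Prod C X B) D h (pairing C (Prod C X A) X B (Pr1 C X A) g)),
      One = One C,
      Prod = Prod C,
      Pr1 = (\<lambda>A B.
        Comp C (Prod C X (Prod C A B)) (Prod C A B) A (Pr1 C A B) (Pr2 C X (Prod C A B))),
      Pr2 = (\<lambda>A B.
        Comp C (Prod C X (Prod C A B)) (Prod C A B) B (Pr2 C A B) (Pr2 C X (Prod C A B)))\<rparr>"

definition kleisli_doctrine ::
    "('o, 'm, 'a) doctrine \<Rightarrow> 'o \<Rightarrow> 'a \<Rightarrow> ('o, 'm, 'a) doctrine" where
  "kleisli_doctrine P X \<phi> =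
     (let C = base P in
      \<lparr>base = kleisli_category C X,
       fib = (\<lambda>A. (fib P (Prod C X A))
         \<lparr>carrier := {\<alpha> \<in> carrier (fib P (Prod C X A)).
            \<alpha> \<sqsubseteq>\<^bsub>fib P (Prod C X A)\<^esub> reidx P (Prod C X A) X (Pr1 C X A) \<phi>}\<rparr>),
       reidx = (\<lambda>A B g.
         reidx P (Prod C X A) (Prod C X B) (pairing C (Prod C X A) X B (Pr1 C X A) g))\<rparr>)"

definition kleisli_one_arrow ::
    "('o, 'm, 'a) doctrine \<Rightarrow> 'o \<Rightarrow> 'a \<Rightarrow> ('o, 'm, 'a, 'o, 'm, 'a) one_arrow" where
  "kleisli_one_arrow P X \<phi> =
     (let C = base P in
      \<lparr>obj_map = (\<lambda>A. A),
       arr_map = (\<lambda>A B f. Comp C (Prod C X A) A B f (Pr2 C X A)),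
       fib_map = (\<lambda>A \<alpha>.
         reidx P (Prod C X A) X (Pr1 C X A) \<phi>
           \<sqinter>\<^bsub>fib P (Prod C X A)\<^esub> reidx P (Prod C X A) A (Pr2 C X A) \<alpha>)\<rparr>)"

end

theory Submission
  imports Defs
begin

text \<open>
  An arrow \<open>g : A \<leadsto> B\<close> of the Kleisli category induces
  \<open>\<langle>pr\<^sub>1, g\<rangle> : X \<times> A \<rightarrow> X \<times> B\<close>, which commutes with the first
  projections. Hence \<open>P\<langle>pr\<^sub>1, g\<rangle>\<close> fixes \<open>P(pr\<^sub>1)(\<phi>)\<close> and maps
  the elements below it to elements below it. Since these form an ideal of the fiber over
  \<open>X \<times> A\<close>, their joins are computed in that fiber, so that binary joins and their
  preservation under reindexing are inherited from \<open>P\<close>. The canonical 1-arrow preserves joins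
  because meeting with \<open>P(pr\<^sub>1)(\<phi>)\<close> does, by distributivity.
\<close>

section \<open>Restriction of orders to subsets\<close>

lemma (in partial_order) partial_order_restrict:
  assumes "S \<subseteq> carrier L"
  shows "partial_order (L\<lparr>carrier := S\<rparr>)"
proof -
  have sub: "x \<in> carrier L" if "x \<in> S" for x
    using assms that by blast
  show ?thesis
    by unfold_locales (auto simp: eq_is_equal intro: sub le_trans le_antisym)
qed

context upper_semilattice
begin

text \<open>Upper bounds of \<open>{x, y}\<close> within \<open>S\<close> are upper bounds in
  \<open>L\<close>, so the join of \<open>L\<close> lies below all of them; once it belongs to
  \<open>S\<close>, it is the least of them.\<close>

lemma least_restrict:
  assumes "S \<subseteq> carrier L" "x \<in> S" "y \<in> S" "x \<squnion> y \<in> S"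
  shows "least (L\<lparr>carrier := S\<rparr>) (x \<squnion> y) (Upper (L\<lparr>carrier := S\<rparr>) {x, y})"
proof -
  have "x \<in> carrier L" "y \<in> carrier L"
    using assms by blast+
  then show ?thesis
    using assms by (auto simp: least_def Upper_def join_left join_right intro: join_le)
qed

lemma upper_semilattice_restrict:
  assumes "S \<subseteq> carrier L" "\<And>x y. \<lbrakk>x \<in> S; y \<in> S\<rbrakk> \<Longrightarrow> x \<squnion> y \<in> S"
  shows "upper_semilattice (L\<lparr>carrier := S\<rparr>)"
proof -
  interpret sub: partial_order "L\<lparr>carrier := S\<rparr>"
    by (rule partial_order_restrict) (rule assms(1))
  show ?thesis
    using least_restrict[OF assms(1)] assms(2) by unfold_locales (simp, blast)
qed

lemma join_restrict:
  assumes "S \<subseteq> carrier L" "x \<in> S" "y \<in> S" "x \<squnion> y \<in> S"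
  shows "x \<squnion>\<^bsub>L\<lparr>carrier := S\<rparr>\<^esub> y = x \<squnion> y"
proof -
  interpret sub: partial_order "L\<lparr>carrier := S\<rparr>"
    by (rule partial_order_restrict) (rule assms(1))
  show ?thesis
    \<comment> \<open>The join of the restricted order is a choice among least upper bounds relative
      to \<open>S\<close>; antisymmetry leaves a single candidate.\<close>
    unfolding join_def[of "L\<lparr>carrier := S\<rparr>"] sup_def[of "L\<lparr>carrier := S\<rparr>"]
    using least_restrict[OF assms] sub.least_unique by (blast intro: some_equality)
qed

end

lemma (in lower_semilattice) meet_mono_right:
  assumes "x \<in> carrier L" "y \<in> carrier L" "z \<in> carrier L" "y \<sqsubseteq> z"
  shows "x \<sqinter> y \<sqsubseteq> x \<sqinter> z"
  using assms by (meson le_trans meet_closed meet_le meet_left meet_right)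

section \<open>The Kleisli category\<close>

context fp_category
begin

lemma Prod_closed [simp]: "\<lbrakk>A \<in> Ob C; B \<in> Ob C\<rbrakk> \<Longrightarrow> Prod C A B \<in> Ob C"
  and Pr1_closed [simp]: "\<lbrakk>A \<in> Ob C; B \<in> Ob C\<rbrakk> \<Longrightarrow> Pr1 C A B \<in> Hom C (Prod C A B) A"
  and Pr2_closed [simp]: "\<lbrakk>A \<in> Ob C; B \<in> Ob C\<rbrakk> \<Longrightarrow> Pr2 C A B \<in> Hom C (Prod C A B) B"
  using Prod_product[of A B] by (simp_all add: is_product_def)

lemma Prod_universal:
  assumes "A \<in> Ob C" "B \<in> Ob C" "Z \<in> Ob C" "f \<in> Hom C Z A" "g \<in> Hom C Z B"
  shows "\<exists>!h. h \<in> Hom C Z (Prod C A B) \<and>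
    Comp C Z (Prod C A B) A (Pr1 C A B) h = f \<and> Comp C Z (Prod C A B) B (Pr2 C A B) h = g"
  using Prod_product[of A B] assms by (simp add: is_product_def)

lemma
  assumes "A \<in> Ob C" "B \<in> Ob C" "Z \<in> Ob C" "f \<in> Hom C Z A" "g \<in> Hom C Z B"
  shows pairing_closed: "pairing C Z A B f g \<in> Hom C Z (Prod C A B)"
    and Pr1_pairing: "Comp C Z (Prod C A B) A (Pr1 C A B) (pairing C Z A B f g) = f"
    and Pr2_pairing: "Comp C Z (Prod C A B) B (Pr2 C A B) (pairing C Z A B f g) = g"
  using theI'[OF Prod_universal[OF assms]] by (simp_all add: pairing_def)

lemma pairing_eqI:
  assumes "A \<in> Ob C" "B \<in> Ob C" "Z \<in> Ob C" "h \<in> Hom C Z (Prod C A B)"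
    and "Comp C Z (Prod C A B) A (Pr1 C A B) h = f"
    and "Comp C Z (Prod C A B) B (Pr2 C A B) h = g"
  shows "pairing C Z A B f g = h"
proof -
  \<comment> \<open>As composites of \<open>h\<close> with the projections, \<open>f\<close> and
    \<open>g\<close> inherit their types.\<close>
  have "f \<in> Hom C Z A" "g \<in> Hom C Z B"
    using assms Comp_closed[of Z "Prod C A B"] by auto
  then show ?thesis
    unfolding pairing_def using assms by (intro the1_equality Prod_universal) auto
qed

end

section \<open>Graphs of Kleisli arrows, Kleisli products and the canonical functor\<close>

locale pointed_fp_category = fp_category C for C :: "('o, 'm) fp_category" +
  fixes X :: 'o
  assumes X_closed [simp]: "X \<in> Ob C"
begin

text \<open>The Kleisli arrow \<open>g\<close> seen as a morphism over \<open>X\<close> between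
  first projections. In this form Kleisli composition becomes composition in
  \<open>C\<close>.\<close>

abbreviation graph :: "'o \<Rightarrow> 'o \<Rightarrow> 'm \<Rightarrow> 'm" where
  "graph A B g \<equiv> pairing C (Prod C X A) X B (Pr1 C X A) g"

lemma
  assumes "A \<in> Ob C" "B \<in> Ob C" "g \<in> Hom C (Prod C X A) B"
  shows graph_closed: "graph A B g \<in> Hom C (Prod C X A) (Prod C X B)"
    and Pr1_graph: "Comp C (Prod C X A) (Prod C X B) X (Pr1 C X B) (graph A B g) = Pr1 C X A"
    and Pr2_graph: "Comp C (Prod C X A) (Prod C X B) B (Pr2 C X B) (graph A B g) = g"
  using assms by (simp_all add: pairing_closed Pr1_pairing Pr2_pairing)

lemma graph_Pr2: "A \<in> Ob C \<Longrightarrow> graph A A (Pr2 C X A) = Id C (Prod C X A)"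
  by (rule pairing_eqI) (simp_all add: Id_closed Comp_Id_right)

text \<open>Both sides have the same composites with the two projections out of
  \<open>Prod C X D\<close>. Together with \<open>graph_Pr2\<close> this makes \<open>graph\<close>
  functorial, which yields the laws of the Kleisli category and later of its reindexings.\<close>

lemma graph_Comp:
  assumes "A \<in> Ob C" "B \<in> Ob C" "D \<in> Ob C"
    and "g \<in> Hom C (Prod C X A) B" "h \<in> Hom C (Prod C X B) D"
  shows "graph A D (Comp C (Prod C X A) (Prod C X B) D h (graph A B g)) =
    Comp C (Prod C X A) (Prod C X B) (Prod C X D) (graph B D h) (graph A B g)"
  using assms
  by (intro pairing_eqI)
    (simp_all add: Comp_closed graph_closed Comp_assoc Pr1_graph Pr2_graph)

text \<open>Associativity moves \<open>Pr2\<close> onto the graph, where it returns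
  \<open>g\<close>. Hence composing in the Kleisli category with the image of a base arrow is plain
  postcomposition; products and functoriality rest on this.\<close>

lemma Comp_Pr2_graph:
  assumes "A \<in> Ob C" "B \<in> Ob C" "D \<in> Ob C"
    and "g \<in> Hom C (Prod C X A) B" "f \<in> Hom C B D"
  shows "Comp C (Prod C X A) (Prod C X B) D (Comp C (Prod C X B) B D f (Pr2 C X B)) (graph A B g) =
    Comp C (Prod C X A) B D f g"
  using assms by (simp add: Comp_assoc[symmetric] graph_closed Pr2_graph)

lemma kleisli_category: "category (kleisli_category C X)"
  unfolding kleisli_category_def
  by unfold_locales
    (simp_all add: Comp_closed graph_closed graph_Pr2 Comp_Id_right Pr2_graph graph_Comp Comp_assoc)

lemma kleisli_fp_category: "fp_category (kleisli_category C X)"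
proof -
  interpret K: category "kleisli_category C X"
    by (rule kleisli_category)
  show ?thesis
  proof
    show "is_terminal (kleisli_category C X) (One (kleisli_category C X))"
      \<comment> \<open>Kleisli arrows from \<open>Z\<close> to \<open>One C\<close> are arrows of
        \<open>C\<close> out of \<open>Prod C X Z\<close>, so terminality is applied at that
        object.\<close>
      using One_terminal by (auto simp: is_terminal_def kleisli_category_def)
    show "is_product (kleisli_category C X) A B (Prod (kleisli_category C X) A B)
        (Pr1 (kleisli_category C X) A B) (Pr2 (kleisli_category C X) A B)"
      if "A \<in> Ob (kleisli_category C X)" "B \<in> Ob (kleisli_category C X)" for A B
    proof -
      have AB: "A \<in> Ob C" "B \<in> Ob C"
        using that by (simp_all add: kleisli_category_def)
      show ?thesis
        \<comment> \<open>By \<open>Comp_Pr2_graph\<close> the Kleisli universal property at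
          \<open>Z\<close> is that of \<open>C\<close> at \<open>Prod C X Z\<close>. The congruence
          rule makes the type of the mediating arrow available for this rewriting.\<close>
        using AB Prod_universal[OF AB]
        by (simp add: is_product_def kleisli_category_def Comp_closed Comp_Pr2_graph cong: conj_cong)
    qed
  qed
qed

lemma kleisli_fp_functor:
  "fp_functor C (kleisli_category C X) (\<lambda>A. A) (\<lambda>A B f. Comp C (Prod C X A) A B f (Pr2 C X A))"
proof -
  interpret K: fp_category "kleisli_category C X"
    by (rule kleisli_fp_category)
  show ?thesis
  proof
    \<comment> \<open>The chosen terminal object and projections of the Kleisli category are by
      definition the images of those of \<open>C\<close>.\<close>
    show "is_terminal (kleisli_category C X) (One C)"
      using K.One_terminal by (simp add: kleisli_category_def)
    show "is_product (kleisli_category C X) A B (Prod C A B)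
        (Comp C (Prod C X (Prod C A B)) (Prod C A B) A (Pr1 C A B) (Pr2 C X (Prod C A B)))
        (Comp C (Prod C X (Prod C A B)) (Prod C A B) B (Pr2 C A B) (Pr2 C X (Prod C A B)))"
      if "A \<in> Ob C" "B \<in> Ob C" for A B
      using K.Prod_product[of A B] that by (simp add: kleisli_category_def)
  qed (simp_all add: kleisli_category_def Comp_closed Comp_Id_left Comp_Pr2_graph Comp_assoc)
qed

end

section \<open>The Kleisli doctrine\<close>

locale pointed_primary_doctrine = primary_doctrine P for P :: "('o, 'm, 'a) doctrine" +
  fixes X :: 'o and \<phi> :: 'a
  assumes X_in_Ob: "X \<in> Ob (base P)"
    and phi_closed: "\<phi> \<in> carrier (fib P X)"

sublocale pointed_primary_doctrine \<subseteq> pointed_fp_category "base P" X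
  by unfold_locales (rule X_in_Ob)

context pointed_primary_doctrine
begin

abbreviation ctx :: "'o \<Rightarrow> 'o" where
  "ctx A \<equiv> Prod (base P) X A"

text \<open>The top element of the Kleisli fiber over \<open>A\<close>.\<close>

abbreviation weaken :: "'o \<Rightarrow> 'a" where
  "weaken A \<equiv> reidx P (ctx A) X (Pr1 (base P) X A) \<phi>"

abbreviation ideal :: "'o \<Rightarrow> 'a set" where
  "ideal A \<equiv> {\<alpha> \<in> carrier (fib P (ctx A)). \<alpha> \<sqsubseteq>\<^bsub>fib P (ctx A)\<^esub> weaken A}"

abbreviation K :: "('o, 'm, 'a) doctrine" where
  "K \<equiv> kleisli_doctrine P X \<phi>"

lemma kleisli_doctrine_simps [simp]:
  "base K = kleisli_category (base P) X"
  "fib K A = (fib P (ctx A))\<lparr>carrier := ideal A\<rparr>"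
  "reidx K A B g = reidx P (ctx A) (ctx B) (graph A B g)"
  by (simp_all add: kleisli_doctrine_def Let_def)

lemma kleisli_category_simps [simp]:
  "Ob (kleisli_category (base P) X) = Ob (base P)"
  "Hom (kleisli_category (base P) X) A B = Hom (base P) (ctx A) B"
  "Id (kleisli_category (base P) X) A = Pr2 (base P) X A"
  "Comp (kleisli_category (base P) X) A B D h g =
    Comp (base P) (ctx A) (ctx B) D h (graph A B g)"
  by (simp_all add: kleisli_category_def)

section \<open>Reindexing along graphs and the doctrine laws\<close>

lemma reidx_in_carrier:
  assumes "A \<in> Ob (base P)" "B \<in> Ob (base P)" "f \<in> Hom (base P) A B" "\<alpha> \<in> carrier (fib P B)"
  shows "reidx P A B f \<alpha> \<in> carrier (fib P A)"
  using reidx_closed[OF assms(1-3)] assms(4) by blast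

lemma reidx_le:
  assumes "A \<in> Ob (base P)" "B \<in> Ob (base P)" "f \<in> Hom (base P) A B"
    and "\<alpha> \<in> carrier (fib P B)" "\<beta> \<in> carrier (fib P B)" "\<alpha> \<sqsubseteq>\<^bsub>fib P B\<^esub> \<beta>"
  shows "reidx P A B f \<alpha> \<sqsubseteq>\<^bsub>fib P A\<^esub> reidx P A B f \<beta>"
  using use_iso2[OF reidx_mono[OF assms(1-3)]] assms(4-6) by blast

lemma weaken_closed: "A \<in> Ob (base P) \<Longrightarrow> weaken A \<in> carrier (fib P (ctx A))"
  by (simp add: reidx_in_carrier phi_closed)

lemma reidx_graph_weaken:
  assumes "A \<in> Ob (base P)" "B \<in> Ob (base P)" "g \<in> Hom (base P) (ctx A) B"
  shows "reidx P (ctx A) (ctx B) (graph A B g) (weaken B) = weaken A"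
  using assms by (simp add: reidx_Comp[symmetric] graph_closed phi_closed Pr1_graph)

lemma reidx_graph_ideal:
  assumes "A \<in> Ob (base P)" "B \<in> Ob (base P)" "g \<in> Hom (base P) (ctx A) B" "\<alpha> \<in> ideal B"
  shows "reidx P (ctx A) (ctx B) (graph A B g) \<alpha> \<in> ideal A"
  using assms reidx_le[of "ctx A" "ctx B" "graph A B g" \<alpha> "weaken B"]
  by (simp add: reidx_in_carrier graph_closed weaken_closed reidx_graph_weaken)

lemma kleisli_fib_order:
  assumes "A \<in> Ob (base P)"
  shows "partial_order ((fib P (ctx A))\<lparr>carrier := ideal A\<rparr>)"
  using assms by (intro partial_order.partial_order_restrict fib_order) auto

lemma kleisli_is_doctrine: "doctrine K"
proof (rule doctrine.intro)
  show "fp_category (base K)"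
    using kleisli_fp_category by simp
  show "doctrine_axioms K"
  proof (rule doctrine_axioms.intro)
    fix A B g
    assume g: "A \<in> Ob (base K)" "B \<in> Ob (base K)" "g \<in> Hom (base K) A B"
    show "reidx K A B g \<in> carrier (fib K B) \<rightarrow> carrier (fib K A)"
      using g reidx_graph_ideal[of A B g] by simp
    show "isotone (fib K B) (fib K A) (reidx K A B g)"
      using g by (auto simp: graph_closed
          intro!: isotoneI reidx_le partial_order.axioms(1) kleisli_fib_order)
  \<comment> \<open>Functoriality of the Kleisli reindexings combines that of \<open>graph\<close>
    with that of \<open>reidx P\<close>.\<close>
  qed (simp_all add: kleisli_fib_order graph_Pr2 reidx_Id graph_Comp reidx_Comp graph_closed)
qed

section \<open>Binary joins in the Kleisli doctrine\<close>

lemma ideal_join_closed: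
  assumes "binary_join_doctrine P" "A \<in> Ob (base P)" "\<alpha> \<in> ideal A" "\<beta> \<in> ideal A"
  shows "\<alpha> \<squnion>\<^bsub>fib P (ctx A)\<^esub> \<beta> \<in> ideal A"
proof -
  interpret binary_join_doctrine P
    by (rule assms(1))
  interpret L: upper_semilattice "fib P (ctx A)"
    using assms(2) by (intro fib_joins) simp
  show ?thesis
    using assms by (simp add: L.join_le weaken_closed)
qed

lemma kleisli_join:
  assumes "binary_join_doctrine P" "A \<in> Ob (base P)" "\<alpha> \<in> ideal A" "\<beta> \<in> ideal A"
  shows "\<alpha> \<squnion>\<^bsub>(fib P (ctx A))\<lparr>carrier := ideal A\<rparr>\<^esub> \<beta> = \<alpha> \<squnion>\<^bsub>fib P (ctx A)\<^esub> \<beta>"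
  using assms
  by (intro upper_semilattice.join_restrict binary_join_doctrine.fib_joins ideal_join_closed) auto

lemma kleisli_binary_joins:
  assumes "binary_join_doctrine P"
  shows "binary_join_doctrine K"
proof -
  interpret J: binary_join_doctrine P
    by (rule assms)
  show ?thesis
  proof (intro binary_join_doctrine.intro binary_join_doctrine_axioms.intro kleisli_is_doctrine)
    show "upper_semilattice (fib K A)" if "A \<in> Ob (base K)" for A
      using that unfolding kleisli_doctrine_simps
      by (intro upper_semilattice.upper_semilattice_restrict J.fib_joins ideal_join_closed assms) auto
  next
    fix A B g \<alpha> \<beta>
    assume asm: "A \<in> Ob (base K)" "B \<in> Ob (base K)" "g \<in> Hom (base K) A B"
      and "\<alpha> \<in> carrier (fib K B)" "\<beta> \<in> carrier (fib K B)"
    then have ideal: "\<alpha> \<in> ideal B" "\<beta> \<in> ideal B"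
      by simp_all
    have g: "A \<in> Ob (base P)" "B \<in> Ob (base P)" "g \<in> Hom (base P) (ctx A) B"
      using asm by simp_all
    \<comment> \<open>Both Kleisli joins are replaced by ambient ones, the right-hand one because
      reindexing lands in the ideal over \<open>A\<close>. What remains is preservation of joins by
      \<open>P\<close> along the graph.\<close>
    show "reidx K A B g (\<alpha> \<squnion>\<^bsub>fib K B\<^esub> \<beta>) = reidx K A B g \<alpha> \<squnion>\<^bsub>fib K A\<^esub> reidx K A B g \<beta>"
      unfolding kleisli_doctrine_simps
        kleisli_join[OF assms g(2) ideal]
        kleisli_join[OF assms g(1) reidx_graph_ideal[OF g ideal(1)] reidx_graph_ideal[OF g ideal(2)]]
      using g ideal by (intro J.reidx_join) (simp_all add: graph_closed)
  qed
qed

section \<open>The canonical 1-arrow and its preservation of joins\<close>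

lemma kleisli_one_arrow_simps [simp]:
  "obj_map (kleisli_one_arrow P X \<phi>) = (\<lambda>A. A)"
  "arr_map (kleisli_one_arrow P X \<phi>) =
    (\<lambda>A B f. Comp (base P) (ctx A) A B f (Pr2 (base P) X A))"
  "fib_map (kleisli_one_arrow P X \<phi>) A \<alpha> =
    weaken A \<sqinter>\<^bsub>fib P (ctx A)\<^esub> reidx P (ctx A) A (Pr2 (base P) X A) \<alpha>"
  by (simp_all add: kleisli_one_arrow_def Let_def)

lemma fib_map_ideal:
  assumes "A \<in> Ob (base P)" "\<alpha> \<in> carrier (fib P A)"
  shows "weaken A \<sqinter>\<^bsub>fib P (ctx A)\<^esub> reidx P (ctx A) A (Pr2 (base P) X A) \<alpha> \<in> ideal A"
proof -
  interpret L: lower_semilattice "fib P (ctx A)"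
    using assms(1) by (intro fib_meets) simp
  show ?thesis
    using assms by (simp add: weaken_closed reidx_in_carrier L.meet_left)
qed

lemma kleisli_is_one_arrow: "one_arrow P K (kleisli_one_arrow P X \<phi>)"
proof -
  interpret KD: doctrine K
    by (rule kleisli_is_doctrine)
  interpret F: fp_functor "base P" "base K" "obj_map (kleisli_one_arrow P X \<phi>)"
      "arr_map (kleisli_one_arrow P X \<phi>)"
    using kleisli_fp_functor by simp
  show ?thesis
  proof
    fix A assume A: "A \<in> Ob (base P)"
    interpret L: lower_semilattice "fib P (ctx A)"
      using A by (intro fib_meets) simp
    show "fib_map (kleisli_one_arrow P X \<phi>) A
        \<in> carrier (fib P A) \<rightarrow> carrier (fib K (obj_map (kleisli_one_arrow P X \<phi>) A))"
      using A fib_map_ideal[of A] by simp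
    show "isotone (fib P A) (fib K (obj_map (kleisli_one_arrow P X \<phi>) A))
        (fib_map (kleisli_one_arrow P X \<phi>) A)"
      using A by (auto simp: reidx_in_carrier weaken_closed
          intro!: isotoneI partial_order.axioms(1) fib_order kleisli_fib_order L.meet_mono_right reidx_le)
  next
    fix A B f \<alpha>
    assume asm: "A \<in> Ob (base P)" "B \<in> Ob (base P)" "f \<in> Hom (base P) A B" "\<alpha> \<in> carrier (fib P B)"
    let ?g = "Comp (base P) (ctx A) A B f (Pr2 (base P) X A)"
    have g: "?g \<in> Hom (base P) (ctx A) B"
      using asm by (simp add: Comp_closed)
    \<comment> \<open>The second projection after the graph of \<open>?g\<close> is \<open>f\<close>
      after the second projection, so both sides reindex along one arrow. For naturality,
      \<open>reidx_meet\<close> splits off the other factor, \<open>weaken B\<close>, which is sent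
      to \<open>weaken A\<close>.\<close>
    have "reidx P (ctx A) (ctx B) (graph A B ?g) (reidx P (ctx B) B (Pr2 (base P) X B) \<alpha>) =
        reidx P (ctx A) A (Pr2 (base P) X A) (reidx P A B f \<alpha>)"
      using asm g by (simp add: reidx_Comp[symmetric] graph_closed Pr2_graph)
    then show "fib_map (kleisli_one_arrow P X \<phi>) A (reidx P A B f \<alpha>) =
        reidx K (obj_map (kleisli_one_arrow P X \<phi>) A) (obj_map (kleisli_one_arrow P X \<phi>) B)
          (arr_map (kleisli_one_arrow P X \<phi>) A B f) (fib_map (kleisli_one_arrow P X \<phi>) B \<alpha>)"
      using asm g
      by (simp add: reidx_meet graph_closed weaken_closed reidx_in_carrier reidx_graph_weaken)
  qed
qed

lemma kleisli_one_arrow_joins: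
  assumes "binary_join_doctrine P" "\<And>A. A \<in> Ob (base P) \<Longrightarrow> distributive_lattice (fib P A)"
  shows "binary_join_preserving_one_arrow P K (kleisli_one_arrow P X \<phi>)"
proof -
  interpret J: binary_join_doctrine P
    by (rule assms(1))
  interpret KJ: binary_join_doctrine K
    by (rule kleisli_binary_joins) (rule assms(1))
  interpret F: one_arrow P K "kleisli_one_arrow P X \<phi>"
    by (rule kleisli_is_one_arrow)
  show ?thesis
  proof
    fix A \<alpha> \<beta>
    assume asm: "A \<in> Ob (base P)" "\<alpha> \<in> carrier (fib P A)" "\<beta> \<in> carrier (fib P A)"
    \<comment> \<open>Distributivity is applied over \<open>ctx A\<close>, where the meet with
      \<open>weaken A\<close> is formed, after \<open>reidx_join\<close> has carried the join across
      \<open>Pr2\<close>.\<close>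
    interpret L: distributive_lattice "fib P (ctx A)"
      using asm by (intro assms) simp
    show "fib_map (kleisli_one_arrow P X \<phi>) A (\<alpha> \<squnion>\<^bsub>fib P A\<^esub> \<beta>) =
        fib_map (kleisli_one_arrow P X \<phi>) A \<alpha>
          \<squnion>\<^bsub>fib K (obj_map (kleisli_one_arrow P X \<phi>) A)\<^esub> fib_map (kleisli_one_arrow P X \<phi>) A \<beta>"
      unfolding kleisli_doctrine_simps kleisli_one_arrow_simps
        kleisli_join[OF assms(1) asm(1) fib_map_ideal[OF asm(1,2)] fib_map_ideal[OF asm(1,3)]]
      using asm by (simp add: J.reidx_join L.meet_join_distrib weaken_closed reidx_in_carrier)
  qed
qed

end

theorem proposition5p9:
  fixes P :: "('o, 'm, 'a) doctrine" and X :: 'o and \<phi> :: 'a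
  assumes "primary_doctrine P"
    and "X \<in> Ob (base P)"
    and "\<phi> \<in> carrier (fib P X)"
  shows "(binary_join_doctrine P \<longrightarrow> binary_join_doctrine (kleisli_doctrine P X \<phi>)) \<and>
    (binary_join_doctrine P \<and> (\<forall>A\<in>Ob (base P). distributive_lattice (fib P A)) \<longrightarrow>
      binary_join_preserving_one_arrow P (kleisli_doctrine P X \<phi>) (kleisli_one_arrow P X \<phi>))"
proof -
  interpret pointed_primary_doctrine P X \<phi>
    using assms by (simp add: pointed_primary_doctrine_def pointed_primary_doctrine_axioms_def)
  show ?thesis
    using kleisli_binary_joins kleisli_one_arrow_joins by blast
qed

end
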